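(* Let $a,b\in\mathbb{R}$ and let $G$ be a 3-dimensional real connected Lie group with a global basis of left-invariant vector fields $\{e_0,e_1,e_2\}$ whose commutators are $$[e_0,e_1]=-b\,e_1-a\,e_2,\qquad [e_0,e_2]=a\,e_1-b\,e_2,\qquad [e_1,e_2]=0 .$$ Equip $G$ with the left-invariant almost contact structure $(\varphi,\xi,\eta)$ given by $$\varphi e_0=0,\quad \varphi e_1=e_2,\quad \varphi e_2=-e_1,\quad \xi=e_0,\quad \eta(e_0)=1,\quad \eta(e_1)=\eta(e_2)=0,$$ and the left-invariant B-metric $g$ given by $$g(e_0,e_0)=g(e_1,e_1)=-g(e_2,e_2)=1,\qquad g(e_0,e_1)=g(e_0,e_2)=g(e_1,e_2)=0 .$$ Then the almost contact B-metric manifold $(G,\varphi,\xi,\eta,g)$ belongs to the class $\mathcal{F}_4\oplus\mathcal{F}_5$.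
   Context: An almost contact B-metric manifold $(M,\varphi,\xi,\eta,g)$ is a $(2n+1)$-dimensional manifold with a $(1,1)$-tensor field $\varphi$, a vector field $\xi$, a 1-form $\eta$ and a pseudo-Riemannian metric $g$ such that $\varphi\xi=0$, $\varphi^2=-\mathrm{Id}+\eta\otimes\xi$, $\eta\circ\varphi=0$, $\eta(\xi)=1$ and $g(\varphi x,\varphi y)=-g(x,y)+\eta(x)\eta(y)$. Here $\dim G=3$. Let $\nabla$ be the Levi-Civita connection of $g$. The fundamental tensor is $F(x,y,z)=g\bigl((\nabla_x\varphi)y,z\bigr)$. With $(g^{ij})$ the inverse of the matrix $(g_{ij})$ of $g$ in a basis $\{e_i\}$, the Lee forms are $\theta(z)=g^{ij}F(e_i,e_j,z)$ and $\theta^*(z)=g^{ij}F(e_i,\varphi e_j,z)$. Put $\theta_0=\theta(e_0)$, $\theta^*_0=\theta^*(e_0)$. For tangent vectors $x=x^ie_i$, $y=y^ie_i$, $z=z^ie_i$ (indices $0,1,2$) define $$F_4(x,y,z)=\tfrac12\theta_0\bigl\{x^1(y^0z^1+y^1z^0)-x^2(y^0z^2+y^2z^0)\bigr\},$$ $$F_5(x,y,z)=\tfrac12\theta^*_0\bigl\{x^1(y^0z^2+y^2z^0)+x^2(y^0z^1+y^1z^0)\bigr\}.$$ The manifold belongs to the class $\mathcal{F}_4\oplus\mathcal{F}_5$ if $F=F_4+F_5$. *)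

theory Defs
  imports "HOL-Analysis.Analysis" "HOL-Algebra.Group"
begin

section \<open>Smooth functions, manifolds and Lie groups\<close>

fun Ck_on :: "nat \<Rightarrow> ('a::euclidean_space \<Rightarrow> 'b::real_normed_vector) \<Rightarrow> 'a set \<Rightarrow> bool" where
  "Ck_on 0 f S \<longleftrightarrow> continuous_on S f"
| "Ck_on (Suc k) f S \<longleftrightarrow>
     (\<forall>x\<in>S. f differentiable (at x)) \<and> (\<forall>v. Ck_on k (\<lambda>x. frechet_derivative f (at x) v) S)"

text \<open>Only used for open \<open>S\<close>.\<close>

definition smooth_on :: "'a::euclidean_space set \<Rightarrow> ('a \<Rightarrow> 'b::real_normed_vector) \<Rightarrow> bool" where
  "smooth_on S f \<longleftrightarrow> (\<forall>k. Ck_on k f S)"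

text \<open>A chart is a pair of a domain and a coordinate map (relevant on the domain only). The
  manifold is the whole type; its dimension is that of the Euclidean space \<open>'m\<close>. Hausdorffness and
  second countability are left to the type classes of the points.\<close>

type_synonym ('p, 'm) atlas = "('p set \<times> ('p \<Rightarrow> 'm)) set"

definition smooth_atlas :: "('p::topological_space, 'm::euclidean_space) atlas \<Rightarrow> bool" where
  "smooth_atlas A \<longleftrightarrow>
     (\<forall>(U, \<psi>)\<in>A. open U \<and> open (\<psi> ` U) \<and> homeomorphism U (\<psi> ` U) \<psi> (inv_into U \<psi>)) \<and>
     (\<Union>(fst ` A)) = UNIV \<and>
     (\<forall>(U, \<psi>)\<in>A. \<forall>(V, \<kappa>)\<in>A. smooth_on (\<psi> ` (U \<inter> V)) (\<kappa> \<circ> inv_into U \<psi>))"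

definition smooth_map ::
  "('p::topological_space, 'm::euclidean_space) atlas \<Rightarrow>
   ('q::topological_space, 'n::euclidean_space) atlas \<Rightarrow> ('p \<Rightarrow> 'q) \<Rightarrow> bool" where
  "smooth_map A B h \<longleftrightarrow> continuous_on UNIV h \<and>
     (\<forall>(U, \<psi>)\<in>A. \<forall>(V, \<kappa>)\<in>B. smooth_on (\<psi> ` (U \<inter> h -` V)) (\<kappa> \<circ> h \<circ> inv_into U \<psi>))"

definition prod_atlas ::
  "('p, 'm) atlas \<Rightarrow> ('q, 'n) atlas \<Rightarrow> ('p \<times> 'q, 'm \<times> 'n) atlas" where
  "prod_atlas A B = {(U \<times> V, map_prod \<psi> \<kappa>) | U \<psi> V \<kappa>. (U, \<psi>) \<in> A \<and> (V, \<kappa>) \<in> B}"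

definition lie_group ::
  "('p::{t2_space,second_countable_topology}, 'r) monoid_scheme \<Rightarrow>
   ('p, 'm::euclidean_space) atlas \<Rightarrow> bool" where
  "lie_group G A \<longleftrightarrow> group G \<and> carrier G = UNIV \<and> smooth_atlas A \<and>
     smooth_map (prod_atlas A A) A (\<lambda>(p, q). p \<otimes>\<^bsub>G\<^esub> q) \<and>
     smooth_map A A (\<lambda>p. inv\<^bsub>G\<^esub> p)"

definition smooth_functions ::
  "('p::topological_space, 'm::euclidean_space) atlas \<Rightarrow> ('p \<Rightarrow> real) set" where
  "smooth_functions A = {f. \<forall>(U, \<psi>)\<in>A. smooth_on (\<psi> ` U) (f \<circ> inv_into U \<psi>)}"

section \<open>Vector fields\<close>

text \<open>Tangent vectors at \<open>p\<close> are derivations at \<open>p\<close> of the algebra of smooth functions. The value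
  \<open>0\<close> outside this algebra makes equality of HOL functions the right notion of equality.\<close>

definition tangent_space ::
  "('p::topological_space, 'm::euclidean_space) atlas \<Rightarrow> 'p \<Rightarrow> (('p \<Rightarrow> real) \<Rightarrow> real) set" where
  "tangent_space A p = {v.
     (\<forall>f. f \<notin> smooth_functions A \<longrightarrow> v f = 0) \<and>
     (\<forall>f\<in>smooth_functions A. \<forall>h\<in>smooth_functions A. \<forall>c d.
        v (\<lambda>q. c * f q + d * h q) = c * v f + d * v h) \<and>
     (\<forall>f\<in>smooth_functions A. \<forall>h\<in>smooth_functions A.
        v (\<lambda>q. f q * h q) = f p * v h + h p * v f)}"

text \<open>\<open>X f p\<close> is the derivative of \<open>f\<close> at \<open>p\<close> in direction of the value of \<open>X\<close> at \<open>p\<close>.\<close>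

type_synonym 'p vfield = "('p \<Rightarrow> real) \<Rightarrow> ('p \<Rightarrow> real)"

definition vector_fields ::
  "('p::topological_space, 'm::euclidean_space) atlas \<Rightarrow> 'p vfield set" where
  "vector_fields A = {X.
     (\<forall>p. (\<lambda>f. X f p) \<in> tangent_space A p) \<and>
     (\<forall>f\<in>smooth_functions A. X f \<in> smooth_functions A)}"

definition vzero :: "'p vfield" where
  "vzero = (\<lambda>f p. 0)"

definition vadd :: "'p vfield \<Rightarrow> 'p vfield \<Rightarrow> 'p vfield" where
  "vadd X Y = (\<lambda>f p. X f p + Y f p)"

definition vdiff :: "'p vfield \<Rightarrow> 'p vfield \<Rightarrow> 'p vfield" where
  "vdiff X Y = (\<lambda>f p. X f p - Y f p)"

definition vscale :: "('p \<Rightarrow> real) \<Rightarrow> 'p vfield \<Rightarrow> 'p vfield" where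
  "vscale h X = (\<lambda>f p. h p * X f p)"

definition lie_bracket :: "'p vfield \<Rightarrow> 'p vfield \<Rightarrow> 'p vfield" where
  "lie_bracket X Y = (\<lambda>f p. X (Y f) p - Y (X f) p)"

definition global_frame ::
  "('p::topological_space, 'm::euclidean_space) atlas \<Rightarrow> ('i::finite \<Rightarrow> 'p vfield) \<Rightarrow> bool" where
  "global_frame A e \<longleftrightarrow> (\<forall>i. e i \<in> vector_fields A) \<and>
     (\<forall>p. \<forall>v\<in>tangent_space A p. \<exists>!c :: 'i \<Rightarrow> real. v = (\<lambda>f. \<Sum>i\<in>UNIV. c i * e i f p))"

text \<open>The component functions \<open>X\<^sup>i\<close> with respect to a global frame.\<close>

definition component :: "('i::finite \<Rightarrow> 'p vfield) \<Rightarrow> 'p vfield \<Rightarrow> 'i \<Rightarrow> 'p \<Rightarrow> real" where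
  "component e X i p =
     (THE c :: 'i \<Rightarrow> real. (\<lambda>f. X f p) = (\<lambda>f. \<Sum>j\<in>UNIV. c j * e j f p)) i"

section \<open>Tensor fields, as maps linear over the smooth functions\<close>

definition one_form ::
  "('p::topological_space, 'm::euclidean_space) atlas \<Rightarrow> ('p vfield \<Rightarrow> 'p \<Rightarrow> real) \<Rightarrow> bool" where
  "one_form A \<eta> \<longleftrightarrow>
     (\<forall>X\<in>vector_fields A. \<eta> X \<in> smooth_functions A) \<and>
     (\<forall>X\<in>vector_fields A. \<forall>Y\<in>vector_fields A. \<forall>p. \<eta> (vadd X Y) p = \<eta> X p + \<eta> Y p) \<and>
     (\<forall>h\<in>smooth_functions A. \<forall>X\<in>vector_fields A. \<forall>p. \<eta> (vscale h X) p = h p * \<eta> X p)"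

definition tensor_1_1 ::
  "('p::topological_space, 'm::euclidean_space) atlas \<Rightarrow> ('p vfield \<Rightarrow> 'p vfield) \<Rightarrow> bool" where
  "tensor_1_1 A \<phi> \<longleftrightarrow>
     (\<forall>X\<in>vector_fields A. \<phi> X \<in> vector_fields A) \<and>
     (\<forall>X\<in>vector_fields A. \<forall>Y\<in>vector_fields A. \<phi> (vadd X Y) = vadd (\<phi> X) (\<phi> Y)) \<and>
     (\<forall>h\<in>smooth_functions A. \<forall>X\<in>vector_fields A. \<phi> (vscale h X) = vscale h (\<phi> X))"

text \<open>Constancy of the signature is automatic on a connected manifold.\<close>

definition pseudo_riemannian_metric ::
  "('p::topological_space, 'm::euclidean_space) atlas \<Rightarrow>
   ('p vfield \<Rightarrow> 'p vfield \<Rightarrow> 'p \<Rightarrow> real) \<Rightarrow> bool" where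
  "pseudo_riemannian_metric A g \<longleftrightarrow>
     (\<forall>X\<in>vector_fields A. one_form A (g X)) \<and>
     (\<forall>X\<in>vector_fields A. \<forall>Y\<in>vector_fields A. g X Y = g Y X) \<and>
     (\<forall>X\<in>vector_fields A. \<forall>p. (\<forall>Y\<in>vector_fields A. g X Y p = 0) \<longrightarrow> (\<forall>f. X f p = 0))"

section \<open>Left invariance\<close>

text \<open>The push-forward of a vector field by the left translation by \<open>a\<close>.\<close>

definition left_push :: "('p, 'r) monoid_scheme \<Rightarrow> 'p \<Rightarrow> 'p vfield \<Rightarrow> 'p vfield" where
  "left_push G a X = (\<lambda>f p. X (\<lambda>q. f (a \<otimes>\<^bsub>G\<^esub> q)) (inv\<^bsub>G\<^esub> a \<otimes>\<^bsub>G\<^esub> p))"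

definition left_invariant_vfield :: "('p, 'r) monoid_scheme \<Rightarrow> 'p vfield \<Rightarrow> bool" where
  "left_invariant_vfield G X \<longleftrightarrow> (\<forall>a. left_push G a X = X)"

definition left_invariant_one_form ::
  "('p::topological_space, 'r) monoid_scheme \<Rightarrow> ('p, 'm::euclidean_space) atlas \<Rightarrow>
   ('p vfield \<Rightarrow> 'p \<Rightarrow> real) \<Rightarrow> bool" where
  "left_invariant_one_form G A \<eta> \<longleftrightarrow>
     (\<forall>a. \<forall>X\<in>vector_fields A. \<forall>p. \<eta> (left_push G a X) (a \<otimes>\<^bsub>G\<^esub> p) = \<eta> X p)"

definition left_invariant_tensor_1_1 ::
  "('p::topological_space, 'r) monoid_scheme \<Rightarrow> ('p, 'm::euclidean_space) atlas \<Rightarrow>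
   ('p vfield \<Rightarrow> 'p vfield) \<Rightarrow> bool" where
  "left_invariant_tensor_1_1 G A \<phi> \<longleftrightarrow>
     (\<forall>a. \<forall>X\<in>vector_fields A. \<phi> (left_push G a X) = left_push G a (\<phi> X))"

definition left_invariant_metric ::
  "('p::topological_space, 'r) monoid_scheme \<Rightarrow> ('p, 'm::euclidean_space) atlas \<Rightarrow>
   ('p vfield \<Rightarrow> 'p vfield \<Rightarrow> 'p \<Rightarrow> real) \<Rightarrow> bool" where
  "left_invariant_metric G A g \<longleftrightarrow>
     (\<forall>a. \<forall>X\<in>vector_fields A. \<forall>Y\<in>vector_fields A. \<forall>p.
        g (left_push G a X) (left_push G a Y) (a \<otimes>\<^bsub>G\<^esub> p) = g X Y p)"

section \<open>The Levi-Civita connection\<close>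

text \<open>Connections are normalised to vanish on arguments that are not vector fields, so that the
  Levi-Civita connection is unique as a HOL function.\<close>

definition affine_connection ::
  "('p::topological_space, 'm::euclidean_space) atlas \<Rightarrow>
   ('p vfield \<Rightarrow> 'p vfield \<Rightarrow> 'p vfield) \<Rightarrow> bool" where
  "affine_connection A D \<longleftrightarrow>
     (\<forall>X Y. X \<notin> vector_fields A \<or> Y \<notin> vector_fields A \<longrightarrow> D X Y = vzero) \<and>
     (\<forall>X\<in>vector_fields A. \<forall>Y\<in>vector_fields A. D X Y \<in> vector_fields A) \<and>
     (\<forall>X\<in>vector_fields A. \<forall>Y\<in>vector_fields A. \<forall>Z\<in>vector_fields A.
        D (vadd X Y) Z = vadd (D X Z) (D Y Z) \<and> D X (vadd Y Z) = vadd (D X Y) (D X Z)) \<and>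
     (\<forall>h\<in>smooth_functions A. \<forall>X\<in>vector_fields A. \<forall>Y\<in>vector_fields A.
        D (vscale h X) Y = vscale h (D X Y) \<and>
        D X (vscale h Y) = vadd (vscale (X h) Y) (vscale h (D X Y)))"

definition is_levi_civita ::
  "('p::topological_space, 'm::euclidean_space) atlas \<Rightarrow>
   ('p vfield \<Rightarrow> 'p vfield \<Rightarrow> 'p \<Rightarrow> real) \<Rightarrow> ('p vfield \<Rightarrow> 'p vfield \<Rightarrow> 'p vfield) \<Rightarrow> bool" where
  "is_levi_civita A g D \<longleftrightarrow> affine_connection A D \<and>
     (\<forall>X\<in>vector_fields A. \<forall>Y\<in>vector_fields A. vdiff (D X Y) (D Y X) = lie_bracket X Y) \<and>
     (\<forall>X\<in>vector_fields A. \<forall>Y\<in>vector_fields A. \<forall>Z\<in>vector_fields A. \<forall>p.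
        X (g Y Z) p = g (D X Y) Z p + g Y (D X Z) p)"

definition levi_civita ::
  "('p::topological_space, 'm::euclidean_space) atlas \<Rightarrow>
   ('p vfield \<Rightarrow> 'p vfield \<Rightarrow> 'p \<Rightarrow> real) \<Rightarrow> 'p vfield \<Rightarrow> 'p vfield \<Rightarrow> 'p vfield" where
  "levi_civita A g = (THE D. is_levi_civita A g D)"

section \<open>Almost contact B-metric manifolds\<close>

definition almost_contact_B_metric ::
  "('p::topological_space, 'm::euclidean_space) atlas \<Rightarrow>
   ('p vfield \<Rightarrow> 'p vfield) \<Rightarrow> 'p vfield \<Rightarrow> ('p vfield \<Rightarrow> 'p \<Rightarrow> real) \<Rightarrow>
   ('p vfield \<Rightarrow> 'p vfield \<Rightarrow> 'p \<Rightarrow> real) \<Rightarrow> bool" where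
  "almost_contact_B_metric A \<phi> \<xi> \<eta> g \<longleftrightarrow>
     smooth_atlas A \<and> odd DIM('m) \<and>
     tensor_1_1 A \<phi> \<and> \<xi> \<in> vector_fields A \<and> one_form A \<eta> \<and> pseudo_riemannian_metric A g \<and>
     \<phi> \<xi> = vzero \<and>
     (\<forall>X\<in>vector_fields A. \<phi> (\<phi> X) = vdiff (vscale (\<eta> X) \<xi>) X) \<and>
     (\<forall>X\<in>vector_fields A. \<forall>p. \<eta> (\<phi> X) p = 0) \<and>
     (\<forall>p. \<eta> \<xi> p = 1) \<and>
     (\<forall>X\<in>vector_fields A. \<forall>Y\<in>vector_fields A. \<forall>p.
        g (\<phi> X) (\<phi> Y) p = - g X Y p + \<eta> X p * \<eta> Y p)"

definition fundamental_tensor ::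
  "('p::topological_space, 'm::euclidean_space) atlas \<Rightarrow> ('p vfield \<Rightarrow> 'p vfield) \<Rightarrow>
   ('p vfield \<Rightarrow> 'p vfield \<Rightarrow> 'p \<Rightarrow> real) \<Rightarrow> 'p vfield \<Rightarrow> 'p vfield \<Rightarrow> 'p vfield \<Rightarrow> 'p \<Rightarrow> real" where
  "fundamental_tensor A \<phi> g X Y Z =
     g (vdiff (levi_civita A g X (\<phi> Y)) (\<phi> (levi_civita A g X Y))) Z"

definition inverse_metric ::
  "('i::finite \<Rightarrow> 'p vfield) \<Rightarrow> ('p vfield \<Rightarrow> 'p vfield \<Rightarrow> 'p \<Rightarrow> real) \<Rightarrow> 'p \<Rightarrow> real ^ 'i ^ 'i" where
  "inverse_metric e g p = matrix_inv (\<chi> i j. g (e i) (e j) p)"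

definition lee_form ::
  "('p::topological_space, 'm::euclidean_space) atlas \<Rightarrow> ('i::finite \<Rightarrow> 'p vfield) \<Rightarrow>
   ('p vfield \<Rightarrow> 'p vfield) \<Rightarrow> ('p vfield \<Rightarrow> 'p vfield \<Rightarrow> 'p \<Rightarrow> real) \<Rightarrow> 'p vfield \<Rightarrow> 'p \<Rightarrow> real" where
  "lee_form A e \<phi> g Z p =
     (\<Sum>i\<in>UNIV. \<Sum>j\<in>UNIV. inverse_metric e g p $ i $ j * fundamental_tensor A \<phi> g (e i) (e j) Z p)"

definition lee_form_star ::
  "('p::topological_space, 'm::euclidean_space) atlas \<Rightarrow> ('i::finite \<Rightarrow> 'p vfield) \<Rightarrow>
   ('p vfield \<Rightarrow> 'p vfield) \<Rightarrow> ('p vfield \<Rightarrow> 'p vfield \<Rightarrow> 'p \<Rightarrow> real) \<Rightarrow> 'p vfield \<Rightarrow> 'p \<Rightarrow> real" where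
  "lee_form_star A e \<phi> g Z p =
     (\<Sum>i\<in>UNIV. \<Sum>j\<in>UNIV.
        inverse_metric e g p $ i $ j * fundamental_tensor A \<phi> g (e i) (\<phi> (e j)) Z p)"

text \<open>The numeral type \<open>3\<close> serves as the index set; its elements are \<open>0\<close>, \<open>1\<close>, \<open>2\<close>. The component
  formulas refer to a frame with \<open>e 0 = \<xi>\<close> and \<open>\<phi> (e 1) = e 2\<close>.\<close>

definition F4_tensor ::
  "('p::topological_space, 'm::euclidean_space) atlas \<Rightarrow> (3 \<Rightarrow> 'p vfield) \<Rightarrow>
   ('p vfield \<Rightarrow> 'p vfield) \<Rightarrow> ('p vfield \<Rightarrow> 'p vfield \<Rightarrow> 'p \<Rightarrow> real) \<Rightarrow>
   'p vfield \<Rightarrow> 'p vfield \<Rightarrow> 'p vfield \<Rightarrow> 'p \<Rightarrow> real" where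
  "F4_tensor A e \<phi> g X Y Z p =
     (let \<theta>0 = lee_form A e \<phi> g (e 0) p;
          x = (\<lambda>i. component e X i p); y = (\<lambda>i. component e Y i p); z = (\<lambda>i. component e Z i p)
      in 1/2 * \<theta>0 * (x 1 * (y 0 * z 1 + y 1 * z 0) - x 2 * (y 0 * z 2 + y 2 * z 0)))"

definition F5_tensor ::
  "('p::topological_space, 'm::euclidean_space) atlas \<Rightarrow> (3 \<Rightarrow> 'p vfield) \<Rightarrow>
   ('p vfield \<Rightarrow> 'p vfield) \<Rightarrow> ('p vfield \<Rightarrow> 'p vfield \<Rightarrow> 'p \<Rightarrow> real) \<Rightarrow>
   'p vfield \<Rightarrow> 'p vfield \<Rightarrow> 'p vfield \<Rightarrow> 'p \<Rightarrow> real" where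
  "F5_tensor A e \<phi> g X Y Z p =
     (let \<theta>s0 = lee_form_star A e \<phi> g (e 0) p;
          x = (\<lambda>i. component e X i p); y = (\<lambda>i. component e Y i p); z = (\<lambda>i. component e Z i p)
      in 1/2 * \<theta>s0 * (x 1 * (y 0 * z 2 + y 2 * z 0) + x 2 * (y 0 * z 1 + y 1 * z 0)))"

definition class_F4_F5 ::
  "('p::topological_space, 'm::euclidean_space) atlas \<Rightarrow> (3 \<Rightarrow> 'p vfield) \<Rightarrow>
   ('p vfield \<Rightarrow> 'p vfield) \<Rightarrow> ('p vfield \<Rightarrow> 'p vfield \<Rightarrow> 'p \<Rightarrow> real) \<Rightarrow> bool" where
  "class_F4_F5 A e \<phi> g \<longleftrightarrow>
     (\<forall>X\<in>vector_fields A. \<forall>Y\<in>vector_fields A. \<forall>Z\<in>vector_fields A. \<forall>p.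
        fundamental_tensor A \<phi> g X Y Z p = F4_tensor A e \<phi> g X Y Z p + F5_tensor A e \<phi> g X Y Z p)"

end

theory Submission
  imports Defs
begin

text \<open>
  The result is a computation in the frame \<open>e\<close>, and the work lies in making such a computation
  legitimate for arbitrary vector fields.

  \<^bold>\<open>Reduction to components.\<close> Tensor fields are maps linear over the ring of smooth functions, so they
  can be evaluated on a vector field \<open>X\<close> by means of its components once these are known to be smooth.
  Here this comes from the metric: in a pseudo-orthonormal frame the components should be
  \<open>\<epsilon> i * g X (e i)\<close>, which is smooth. To prove this formula one needs to know already that \<open>g X\<close>
  depends pointwise on its argument (\<open>one_form_pointwise\<close>): for smooth
  functions \<open>f j\<close> with \<open>e i (f j) p = \<delta>\<^sub>i\<^sub>j\<close>, Cramer's rule writes \<open>det (e i (f j))\<close> times \<open>X\<close> as a combination of the frame with smooth coefficients.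

  \<^bold>\<open>The Levi-Civita connection.\<close> In a pseudo-orthonormal frame, constant Christoffel symbols define an
  affine connection. It is torsion-free and metric as soon as these properties hold on the frame
  (\<open>is_levi_civita_frame_connection\<close>), and a connection with both properties is unique
  (\<open>is_levi_civita_unique\<close>). For the given brackets, Koszul's formula yields the symbols
  \<open>christoffel a b\<close>.

  \<^bold>\<open>The class.\<close> Since \<open>\<phi>\<close> has constant coefficients in the frame, the fundamental tensor is a
  trilinear form in the components (\<open>fundamental_tensor_components\<close>), namely \<open>a\<close> times
  \<open>x\<^sup>1 (y\<^sup>0 z\<^sup>1 + y\<^sup>1 z\<^sup>0) - x\<^sup>2 (y\<^sup>0 z\<^sup>2 + y\<^sup>2 z\<^sup>0)\<close> plus \<open>b\<close> times
  \<open>x\<^sup>1 (y\<^sup>0 z\<^sup>2 + y\<^sup>2 z\<^sup>0) + x\<^sup>2 (y\<^sup>0 z\<^sup>1 + y\<^sup>1 z\<^sup>0)\<close>.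
  Taking traces gives \<open>\<theta>\<^sub>0 = 2 a\<close> and \<open>\<theta>\<^sup>*\<^sub>0 = 2 b\<close>, which turns the two summands into \<open>F\<^sub>4\<close> and \<open>F\<^sub>5\<close>.
\<close>

section \<open>Smooth functions\<close>

text \<open>For open \<open>S\<close>, \<^const>\<open>Ck_on\<close> involves only germs at the points of \<open>S\<close>, but its recursion passes through
  \<^const>\<open>frechet_derivative\<close>, a function on the whole space. This congruence allows the derivative of
  a sum or a product to be replaced by its Leibniz expression, which agrees with it only on \<open>S\<close>.\<close>

lemma Ck_on_cong:
  assumes "open S" "\<And>x. x \<in> S \<Longrightarrow> f x = f' x" "Ck_on k f S"
  shows "Ck_on k f' S"
  using assms(2,3)
proof (induction k arbitrary: f f')
  case 0
  then show ?case
    unfolding Ck_on.simps by (metis continuous_on_eq)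
next
  case (Suc k)
  have diff: "f' differentiable at x" if x: "x \<in> S" for x
  proof -
    have "(f has_derivative frechet_derivative f (at x)) (at x)"
      using Suc.prems(2) x by (simp add: frechet_derivative_works)
    from has_derivative_transform_within_open[OF this assms(1) x Suc.prems(1)] show ?thesis
      unfolding differentiable_def by blast
  qed
  have "Ck_on k (\<lambda>x. frechet_derivative f' (at x) v) S" for v
  proof (rule Suc.IH)
    show "Ck_on k (\<lambda>x. frechet_derivative f (at x) v) S"
      using Suc.prems by simp
    show "frechet_derivative f (at x) v = frechet_derivative f' (at x) v" if "x \<in> S" for x
      using Suc.prems assms(1) that frechet_derivative_transform_within_open[of f x S f'] by simp
  qed
  with diff show ?case by simp
qed

lemma Ck_on_Suc_imp_Ck_on:
  assumes "Ck_on (Suc k) f S"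
  shows "Ck_on k f S"
  using assms
proof (induction k arbitrary: f)
  case 0
  then show ?case
    by (auto intro!: continuous_at_imp_continuous_on differentiable_imp_continuous_within)
next
  case (Suc k)
  then show ?case by (metis Ck_on.simps(2))
qed

lemma Ck_on_const: "Ck_on k (\<lambda>x. c) S"
proof (induction k arbitrary: c)
  case (Suc k)
  then show ?case by simp
qed simp

lemma Ck_on_add:
  assumes "open S" "Ck_on k f S" "Ck_on k h S"
  shows "Ck_on k (\<lambda>x. f x + h x) S"
  using assms(2,3)
proof (induction k arbitrary: f h)
  case 0
  then show ?case by (simp add: continuous_on_add)
next
  case (Suc k)
  have deriv: "((\<lambda>x. f x + h x) has_derivative
      (\<lambda>v. frechet_derivative f (at x) v + frechet_derivative h (at x) v)) (at x)" if "x \<in> S" for x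
    using Suc.prems that by (auto intro!: has_derivative_add simp: frechet_derivative_works)
  have "Ck_on k (\<lambda>x. frechet_derivative (\<lambda>x. f x + h x) (at x) v) S" for v
  proof (rule Ck_on_cong[OF assms(1)])
    show "Ck_on k (\<lambda>x. frechet_derivative f (at x) v + frechet_derivative h (at x) v) S"
      using Suc by simp
  qed (simp add: frechet_derivative_at[OF deriv, symmetric])
  with deriv show ?case by (auto simp: differentiable_def)
qed

lemma Ck_on_mult:
  fixes f h :: "'a::euclidean_space \<Rightarrow> real"
  assumes "open S" "Ck_on k f S" "Ck_on k h S"
  shows "Ck_on k (\<lambda>x. f x * h x) S"
  using assms(2,3)
proof (induction k arbitrary: f h)
  case 0
  then show ?case by (simp add: continuous_on_mult)
next
  case (Suc k)
  have deriv: "((\<lambda>x. f x * h x) has_derivative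
      (\<lambda>v. f x * frechet_derivative h (at x) v + frechet_derivative f (at x) v * h x)) (at x)"
    if "x \<in> S" for x
    using Suc.prems that by (auto intro!: has_derivative_mult simp: frechet_derivative_works)
  have "Ck_on k (\<lambda>x. frechet_derivative (\<lambda>x. f x * h x) (at x) v) S" for v
  proof (rule Ck_on_cong[OF assms(1)])
    show "Ck_on k (\<lambda>x. f x * frechet_derivative h (at x) v + frechet_derivative f (at x) v * h x) S"
    proof (rule Ck_on_add[OF assms(1)])
      show "Ck_on k (\<lambda>x. f x * frechet_derivative h (at x) v) S"
        using Suc.prems by (intro Suc.IH Ck_on_Suc_imp_Ck_on[OF Suc.prems(1)]) simp
      show "Ck_on k (\<lambda>x. frechet_derivative f (at x) v * h x) S"
        using Suc.prems by (intro Suc.IH Ck_on_Suc_imp_Ck_on[OF Suc.prems(2)]) simp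
    qed
  qed (simp add: frechet_derivative_at[OF deriv, symmetric])
  with deriv show ?case by (auto simp: differentiable_def)
qed

lemma smooth_functions_iff:
  "f \<in> smooth_functions A \<longleftrightarrow>
    (\<forall>U \<psi> k. (U, \<psi>) \<in> A \<longrightarrow> Ck_on k (\<lambda>x. f (inv_into U \<psi> x)) (\<psi> ` U))"
  unfolding smooth_functions_def smooth_on_def o_def by blast

lemma smooth_atlas_open: "smooth_atlas A \<Longrightarrow> (U, \<psi>) \<in> A \<Longrightarrow> open (\<psi> ` U)"
  unfolding smooth_atlas_def by blast

lemma smooth_functions_const: "(\<lambda>p. c) \<in> smooth_functions A"
  unfolding smooth_functions_iff using Ck_on_const by blast

section \<open>Vector fields as derivations\<close>

lemma vector_field_smooth:
  "X \<in> vector_fields A \<Longrightarrow> f \<in> smooth_functions A \<Longrightarrow> X f \<in> smooth_functions A"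
  by (simp add: vector_fields_def)

lemma vector_field_outside:
  "X \<in> vector_fields A \<Longrightarrow> f \<notin> smooth_functions A \<Longrightarrow> X f p = 0"
  by (simp add: vector_fields_def tangent_space_def)

lemma vector_field_linear:
  "X \<in> vector_fields A \<Longrightarrow> f \<in> smooth_functions A \<Longrightarrow> h \<in> smooth_functions A \<Longrightarrow>
    X (\<lambda>q. c * f q + d * h q) p = c * X f p + d * X h p"
  by (simp add: vector_fields_def tangent_space_def)

lemma vector_field_mult:
  "X \<in> vector_fields A \<Longrightarrow> f \<in> smooth_functions A \<Longrightarrow> h \<in> smooth_functions A \<Longrightarrow>
    X (\<lambda>q. f q * h q) p = f p * X h p + h p * X f p"
  by (simp add: vector_fields_def tangent_space_def)

lemma vector_field_const:
  assumes "X \<in> vector_fields A"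
  shows "X (\<lambda>q. c) p = 0"
  using vector_field_linear[OF assms smooth_functions_const[of 1] smooth_functions_const[of 1],
      of c 0 p]
    vector_field_mult[OF assms smooth_functions_const[of 1] smooth_functions_const[of 1], of p]
  by simp

lemma vector_field_add:
  assumes "X \<in> vector_fields A" "f \<in> smooth_functions A" "h \<in> smooth_functions A"
  shows "X (\<lambda>q. f q + h q) p = X f p + X h p"
  using vector_field_linear[OF assms, of 1 1 p] by simp

lemma vector_field_cmult:
  assumes "X \<in> vector_fields A" "f \<in> smooth_functions A"
  shows "X (\<lambda>q. c * f q) p = c * X f p"
  using vector_field_linear[OF assms assms(2), of c 0 p] by simp

lemma vzero_in_vector_fields: "vzero \<in> vector_fields A"
  by (auto simp: vector_fields_def tangent_space_def vzero_def smooth_functions_const)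

lemma vdiff_eq_vadd_vscale: "vdiff X Y = vadd X (vscale (\<lambda>p. - 1) Y)"
  by (simp add: vdiff_def vadd_def vscale_def)

context
  fixes A :: "('p::topological_space, 'm::euclidean_space) atlas"
  assumes atlas: "smooth_atlas A"
begin

section \<open>The ring of smooth functions\<close>

lemma smooth_functions_add:
  assumes "f \<in> smooth_functions A" "h \<in> smooth_functions A"
  shows "(\<lambda>p. f p + h p) \<in> smooth_functions A"
  using assms Ck_on_add smooth_atlas_open[OF atlas] unfolding smooth_functions_iff by blast

lemma smooth_functions_mult:
  assumes "f \<in> smooth_functions A" "h \<in> smooth_functions A"
  shows "(\<lambda>p. f p * h p) \<in> smooth_functions A"
  using assms Ck_on_mult smooth_atlas_open[OF atlas] unfolding smooth_functions_iff by blast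

lemma smooth_functions_sum:
  assumes "\<And>i. i \<in> I \<Longrightarrow> f i \<in> smooth_functions A"
  shows "(\<lambda>p. \<Sum>i\<in>I. f i p) \<in> smooth_functions A"
  using assms
  by (induction I rule: infinite_finite_induct)
    (auto simp: smooth_functions_const intro: smooth_functions_add)

lemma smooth_functions_prod:
  assumes "\<And>i. i \<in> I \<Longrightarrow> f i \<in> smooth_functions A"
  shows "(\<lambda>p. \<Prod>i\<in>I. f i p) \<in> smooth_functions A"
  using assms
  by (induction I rule: infinite_finite_induct)
    (auto simp: smooth_functions_const intro: smooth_functions_mult)

text \<open>Minors of a matrix of smooth functions are smooth; this makes Cramer's rule available over the
  ring of smooth functions.\<close>

lemma smooth_functions_det:
  fixes M :: "'i::finite \<Rightarrow> 'i \<Rightarrow> 'p \<Rightarrow> real"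
  assumes "\<And>i j. M i j \<in> smooth_functions A"
  shows "(\<lambda>p. det (\<chi> i j. M i j p)) \<in> smooth_functions A"
  unfolding det_def
  using assms
  by (auto intro!: smooth_functions_sum smooth_functions_mult smooth_functions_prod
      smooth_functions_const)

section \<open>The module of vector fields\<close>

lemma vector_field_sum:
  assumes "X \<in> vector_fields A" "\<And>i. i \<in> I \<Longrightarrow> f i \<in> smooth_functions A"
  shows "X (\<lambda>q. \<Sum>i\<in>I. f i q) p = (\<Sum>i\<in>I. X (f i) p)"
  using assms(2)
  by (induction I rule: infinite_finite_induct)
    (auto simp: vector_field_const[OF assms(1)] vector_field_add[OF assms(1)] smooth_functions_sum)

lemma vscale_in_vector_fields:
  assumes "h \<in> smooth_functions A" "X \<in> vector_fields A"
  shows "vscale h X \<in> vector_fields A"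
  using assms
  by (auto simp: vector_fields_def tangent_space_def vscale_def algebra_simps
      intro!: smooth_functions_mult)

lemma vadd_in_vector_fields:
  assumes "X \<in> vector_fields A" "Y \<in> vector_fields A"
  shows "vadd X Y \<in> vector_fields A"
  using assms
  by (auto simp: vector_fields_def tangent_space_def vadd_def algebra_simps
      intro!: smooth_functions_add)

lemma vdiff_in_vector_fields:
  "X \<in> vector_fields A \<Longrightarrow> Y \<in> vector_fields A \<Longrightarrow> vdiff X Y \<in> vector_fields A"
  by (simp add: vdiff_eq_vadd_vscale vadd_in_vector_fields vscale_in_vector_fields
      smooth_functions_const)

lemma vector_fields_sum:
  fixes e :: "'i \<Rightarrow> 'p vfield"
  assumes "finite I" "\<And>i. i \<in> I \<Longrightarrow> e i \<in> vector_fields A"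
    and "\<And>i. i \<in> I \<Longrightarrow> h i \<in> smooth_functions A"
  shows "(\<lambda>f p. \<Sum>i\<in>I. h i p * e i f p) \<in> vector_fields A"
  using assms
proof (induction I)
  case empty
  show ?case using vzero_in_vector_fields by (simp add: vzero_def)
next
  case (insert i I)
  then have "vadd (vscale (h i) (e i)) (\<lambda>f p. \<Sum>i\<in>I. h i p * e i f p) \<in> vector_fields A"
    by (intro vadd_in_vector_fields vscale_in_vector_fields) auto
  then show ?case
    using insert by (simp add: vadd_def vscale_def)
qed

lemma one_form_vdiff:
  assumes "one_form A \<omega>" "X \<in> vector_fields A" "Y \<in> vector_fields A"
  shows "\<omega> (vdiff X Y) p = \<omega> X p - \<omega> Y p"
  using assms vscale_in_vector_fields[OF smooth_functions_const[of "-1"] assms(3)]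
  by (simp add: one_form_def vdiff_eq_vadd_vscale smooth_functions_const)

lemma one_form_sum:
  fixes e :: "'i \<Rightarrow> 'p vfield"
  assumes "one_form A \<omega>" "finite I" "\<And>i. i \<in> I \<Longrightarrow> e i \<in> vector_fields A"
    and "\<And>i. i \<in> I \<Longrightarrow> h i \<in> smooth_functions A"
  shows "\<omega> (\<lambda>f p. \<Sum>i\<in>I. h i p * e i f p) p = (\<Sum>i\<in>I. h i p * \<omega> (e i) p)"
  using assms(2-4)
proof (induction I)
  case empty
  have "\<omega> (vscale (\<lambda>p. 0) vzero) p = 0"
    using assms(1) by (simp add: one_form_def vzero_in_vector_fields smooth_functions_const)
  then show ?case by (simp add: vscale_def)
next
  case (insert i I)
  then have "(\<lambda>f p. \<Sum>i\<in>insert i I. h i p * e i f p) =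
      vadd (vscale (h i) (e i)) (\<lambda>f p. \<Sum>i\<in>I. h i p * e i f p)"
    by (simp add: vadd_def vscale_def)
  with insert assms(1) show ?case
    by (simp add: one_form_def vscale_in_vector_fields vector_fields_sum)
qed

lemma tensor_1_1_sum:
  fixes e :: "'i \<Rightarrow> 'p vfield"
  assumes "tensor_1_1 A \<phi>" "finite I" "\<And>i. i \<in> I \<Longrightarrow> e i \<in> vector_fields A"
    and "\<And>i. i \<in> I \<Longrightarrow> h i \<in> smooth_functions A"
  shows "\<phi> (\<lambda>f p. \<Sum>i\<in>I. h i p * e i f p) = (\<lambda>f p. \<Sum>i\<in>I. h i p * \<phi> (e i) f p)"
  using assms(2-4)
proof (induction I)
  case empty
  have "\<phi> (vscale (\<lambda>p. 0) vzero) = vscale (\<lambda>p. 0) (\<phi> vzero)"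
    using assms(1) by (simp add: tensor_1_1_def vzero_in_vector_fields smooth_functions_const)
  then show ?case by (simp add: vscale_def)
next
  case (insert i I)
  then have "(\<lambda>f p. \<Sum>i\<in>insert i I. h i p * e i f p) =
      vadd (vscale (h i) (e i)) (\<lambda>f p. \<Sum>i\<in>I. h i p * e i f p)"
    by (simp add: vadd_def vscale_def)
  with insert assms(1) show ?case
    by (simp add: tensor_1_1_def vscale_in_vector_fields vector_fields_sum)
      (simp add: vadd_def vscale_def)
qed

section \<open>Frames and tensoriality\<close>

text \<open>Uniqueness of the coefficients, applied to the tangent vector \<open>0\<close>, makes the functionals
  \<open>f \<mapsto> e i f p\<close> linearly independent. If the vectors \<open>(e i f p)\<^sub>i\<close> for smooth \<open>f\<close> did not fill
  \<open>\<real>\<^sup>n\<close>, a vector orthogonal to all of them would be a nontrivial linear relation. Such functions are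
  thus globally smooth by construction.\<close>

lemma global_frame_dual_functions:
  fixes e :: "'i::finite \<Rightarrow> 'p vfield"
  assumes "global_frame A e"
  obtains f :: "'i \<Rightarrow> 'p \<Rightarrow> real"
  where "\<And>j. f j \<in> smooth_functions A" "\<And>i j. e i (f j) p = (if i = j then 1 else 0)"
proof -
  have vf: "e i \<in> vector_fields A" for i
    using assms by (simp add: global_frame_def)
  define S :: "(real ^ 'i) set" where "S = (\<lambda>f. \<chi> i. e i f p) ` smooth_functions A"
  have "subspace S"
    unfolding subspace_def
  proof (intro conjI ballI allI)
    show "0 \<in> S"
      unfolding S_def using smooth_functions_const[of 0 A]
      by (intro image_eqI[where x = "\<lambda>q. 0"]) (simp_all add: vec_eq_iff vector_field_const[OF vf])
  next
    fix x y assume "x \<in> S" "y \<in> S"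
    then obtain f h where "f \<in> smooth_functions A" "h \<in> smooth_functions A"
        "x = (\<chi> i. e i f p)" "y = (\<chi> i. e i h p)"
      unfolding S_def by auto
    then show "x + y \<in> S"
      unfolding S_def
      by (intro image_eqI[where x = "\<lambda>q. f q + h q"])
        (simp_all add: vec_eq_iff vector_field_add[OF vf] smooth_functions_add)
  next
    fix c x assume "x \<in> S"
    then obtain f where "f \<in> smooth_functions A" "x = (\<chi> i. e i f p)"
      unfolding S_def by auto
    then show "c *\<^sub>R x \<in> S"
      unfolding S_def
      by (intro image_eqI[where x = "\<lambda>q. c * f q"])
        (simp_all add: vec_eq_iff vector_field_cmult[OF vf] smooth_functions_mult
          smooth_functions_const)
  qed
  have "S = UNIV"
  proof (rule ccontr)
    assume "S \<noteq> UNIV"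
    then have "dim S < DIM(real ^ 'i)"
      using \<open>subspace S\<close> by (metis dim_eq_full dim_subset_UNIV le_neq_implies_less span_eq_iff)
    then obtain c :: "real ^ 'i" where c: "c \<noteq> 0" "\<And>y. y \<in> span S \<Longrightarrow> orthogonal c y"
      using orthogonal_to_subspace_exists by blast
    have relation: "(\<Sum>i\<in>UNIV. c $ i * e i f p) = 0" for f
    proof (cases "f \<in> smooth_functions A")
      case True
      then have "orthogonal c (\<chi> i. e i f p)"
        by (intro c(2) span_base) (auto simp: S_def)
      then show ?thesis by (simp add: orthogonal_def inner_vec_def)
    next
      case False
      then show ?thesis by (simp add: vector_field_outside[OF vf])
    qed
    \<comment> \<open>The zero tangent vector has the coefficients \<open>c\<close> and also the coefficients \<open>0\<close>.\<close>
    have "(\<lambda>f. 0) \<in> tangent_space A p"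
      by (simp add: tangent_space_def)
    then have unique: "\<exists>!c :: 'i \<Rightarrow> real. (\<lambda>f. 0) = (\<lambda>f. \<Sum>i\<in>UNIV. c i * e i f p)"
      using assms by (simp add: global_frame_def)
    obtain d :: "'i \<Rightarrow> real"
      where d: "\<forall>c. (\<lambda>f. 0) = (\<lambda>f. \<Sum>i\<in>UNIV. c i * e i f p) \<longrightarrow> c = d"
      using unique by (rule ex1E)
    have "($) c = d" "(\<lambda>i. 0) = d"
      by (rule d[rule_format], simp add: relation)+
    then have "($) c = (\<lambda>i. 0)" by simp
    with c(1) show False by (simp add: vec_eq_iff fun_eq_iff)
  qed
  then have "\<exists>f \<in> smooth_functions A. (axis j 1 :: real ^ 'i) = (\<chi> i. e i f p)" for j
    unfolding S_def by blast
  then obtain f where "\<And>j. f j \<in> smooth_functions A"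
      "\<And>j. (axis j 1 :: real ^ 'i) = (\<chi> i. e i (f j) p)"
    by metis
  then show ?thesis
    by (intro that[of f]) (auto simp: vec_eq_iff axis_def)
qed

lemma component_unique:
  fixes e :: "'i::finite \<Rightarrow> 'p vfield"
  assumes "global_frame A e" "X \<in> vector_fields A"
    and "\<And>f. X f p = (\<Sum>i\<in>UNIV. c i * e i f p)"
  shows "component e X i p = c i"
proof -
  have "\<exists>!c :: 'i \<Rightarrow> real. (\<lambda>f. X f p) = (\<lambda>f. \<Sum>j\<in>UNIV. c j * e j f p)"
    using assms(1,2) by (simp add: global_frame_def vector_fields_def)
  then have "(THE c :: 'i \<Rightarrow> real. (\<lambda>f. X f p) = (\<lambda>f. \<Sum>j\<in>UNIV. c j * e j f p)) = c"
    by (rule the1_equality) (simp add: assms(3))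
  then show ?thesis by (simp add: component_def)
qed

lemma frame_expansion:
  fixes e :: "'i::finite \<Rightarrow> 'p vfield"
  assumes "global_frame A e" "X \<in> vector_fields A"
  shows "X f p = (\<Sum>i\<in>UNIV. component e X i p * e i f p)"
proof -
  have "\<exists>c :: 'i \<Rightarrow> real. (\<lambda>f. X f p) = (\<lambda>f. \<Sum>j\<in>UNIV. c j * e j f p)"
    using assms by (fastforce simp: global_frame_def vector_fields_def)
  then obtain c :: "'i \<Rightarrow> real" where c: "\<And>f. X f p = (\<Sum>j\<in>UNIV. c j * e j f p)"
    by metis
  with component_unique[OF assms c] show ?thesis by simp
qed

text \<open>Choose \<open>f j\<close> dual to the frame at \<open>p\<close>. The components of \<open>X\<close> solve, at every point \<open>q\<close>, the linear
  system \<open>(\<Sum>i. X\<^sup>i e i (f j)) = X (f j)\<close> with smooth entries. Let \<open>D\<close> be its determinant; Cramer's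
  rule without the division says that each \<open>D X\<^sup>i\<close> is a smooth determinant, even where \<open>D\<close>
  vanishes. So \<open>D X\<close> is a combination of the frame over the smooth functions, although the
  smoothness of the components of \<open>X\<close> itself is not known at this point.\<close>

lemma frame_expansion_cleared:
  fixes e :: "'i::finite \<Rightarrow> 'p vfield"
  assumes frame: "global_frame A e" and X: "X \<in> vector_fields A"
  obtains D d where "D \<in> smooth_functions A" "D p = 1" "\<And>i. d i \<in> smooth_functions A"
    "vscale D X = (\<lambda>f q. \<Sum>i\<in>UNIV. d i q * e i f q)"
    "\<And>i q. d i q = D q * component e X i q"
proof -
  have vf: "e i \<in> vector_fields A" for i
    using frame by (simp add: global_frame_def)
  obtain f :: "'i \<Rightarrow> 'p \<Rightarrow> real" where f: "\<And>j. f j \<in> smooth_functions A"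
      "\<And>i j. e i (f j) p = (if i = j then 1 else 0)"
    using global_frame_dual_functions[OF frame] by blast
  define M :: "'p \<Rightarrow> real ^ 'i ^ 'i" where "M q = (\<chi> j i. e i (f j) q)" for q
  define D where "D q = det (M q)" for q
  define d where "d k q = det (\<chi> j i. if i = k then X (f j) q else e i (f j) q)" for k q
  have Cramer: "d k q = D q * component e X k q" for k q
  proof -
    have "(M q *v (\<chi> i. component e X i q)) $ j = X (f j) q" for j
      by (simp add: M_def matrix_vector_mult_def frame_expansion[OF frame X, of "f j" q] mult.commute)
    then show ?thesis
      using cramer_lemma[of k "M q" "\<chi> i. component e X i q"]
      by (simp add: d_def D_def M_def mult.commute cong: if_cong)
  qed
  show ?thesis
  proof (rule that)
    show "D \<in> smooth_functions A"
      unfolding D_def M_def by (intro smooth_functions_det vector_field_smooth[OF vf] f)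
    have "M p = mat 1" by (auto simp: M_def mat_def f(2) vec_eq_iff)
    then show "D p = 1" by (simp add: D_def)
    show "d k \<in> smooth_functions A" for k
    proof -
      have "(\<lambda>q. if i = k then X (f j) q else e i (f j) q) \<in> smooth_functions A" for i j
        using vector_field_smooth[OF vf f(1)] vector_field_smooth[OF X f(1)] by (cases "i = k") simp_all
      then show ?thesis
        unfolding d_def by (rule smooth_functions_det)
    qed
    show "vscale D X = (\<lambda>f q. \<Sum>i\<in>UNIV. d i q * e i f q)"
      by (simp add: vscale_def Cramer frame_expansion[OF frame X] sum_distrib_left mult.assoc)
    show "d k q = D q * component e X k q" for k q by (rule Cramer)
  qed
qed

text \<open>A one-form is only given as a map that is linear over the smooth functions. The multiple \<open>D X\<close> from
  the preceding lemma has smooth coefficients, so linearity applies to it, and \<open>D p = 1\<close> removes the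
  factor at \<open>p\<close>.\<close>

lemma one_form_pointwise:
  fixes e :: "'i::finite \<Rightarrow> 'p vfield"
  assumes frame: "global_frame A e" and X: "X \<in> vector_fields A" and form: "one_form A \<omega>"
  shows "\<omega> X p = (\<Sum>i\<in>UNIV. component e X i p * \<omega> (e i) p)"
proof -
  obtain D d where D: "D \<in> smooth_functions A" "D p = 1" "\<And>i. d i \<in> smooth_functions A"
      "vscale D X = (\<lambda>f q. \<Sum>i\<in>UNIV. d i q * e i f q)"
      "\<And>i q. d i q = D q * component e X i q"
    by (rule frame_expansion_cleared[OF frame X, of p]) (rule that)
  have "\<omega> X p = \<omega> (vscale D X) p"
    using form D(1,2) X by (simp add: one_form_def)
  also have "\<dots> = (\<Sum>i\<in>UNIV. d i p * \<omega> (e i) p)"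
    unfolding D(4) using frame D(3) by (intro one_form_sum[OF form]) (auto simp: global_frame_def)
  finally show ?thesis by (simp add: D(2,5))
qed

end

section \<open>Uniqueness of the Levi-Civita connection\<close>

text \<open>The difference \<open>S\<close> of two Levi-Civita connections is symmetric because both are torsion-free, and
  \<open>g (S X Y) Z\<close> is skew in \<open>Y\<close> and \<open>Z\<close> because both are metric. A trilinear expression that is
  symmetric in one pair of adjacent arguments and skew in the other vanishes, so \<open>S\<close> vanishes by
  nondegeneracy.\<close>

lemma is_levi_civita_unique:
  fixes A :: "('p::topological_space, 'm::euclidean_space) atlas"
  assumes atlas: "smooth_atlas A" and metric: "pseudo_riemannian_metric A g"
    and D: "is_levi_civita A g D" and D': "is_levi_civita A g D'"
  shows "D = D'"
proof (intro ext)
  fix X Y f p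
  have affine: "affine_connection A D" "affine_connection A D'"
    using D D' by (simp_all add: is_levi_civita_def)
  have vf: "D U V \<in> vector_fields A" "D' U V \<in> vector_fields A"
    if "U \<in> vector_fields A" "V \<in> vector_fields A" for U V
    using affine that by (simp_all add: affine_connection_def)
  have g_sym: "g U V = g V U" if "U \<in> vector_fields A" "V \<in> vector_fields A" for U V
    using metric that by (simp add: pseudo_riemannian_metric_def)
  have g_form: "one_form A (g U)" if "U \<in> vector_fields A" for U
    using metric that by (simp add: pseudo_riemannian_metric_def)
  define S where "S U V = vdiff (D U V) (D' U V)" for U V
  have S_vf: "S U V \<in> vector_fields A" if "U \<in> vector_fields A" "V \<in> vector_fields A" for U V
    unfolding S_def using vdiff_in_vector_fields[OF atlas] vf that by simp
  have S_sym: "S U V = S V U" if UV: "U \<in> vector_fields A" "V \<in> vector_fields A" for U V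
  proof -
    have "vdiff (D U V) (D V U) = vdiff (D' U V) (D' V U)"
      using D D' UV by (simp add: is_levi_civita_def)
    then have "D U V h q - D V U h q = D' U V h q - D' V U h q" for h q
      by (simp add: vdiff_def fun_eq_iff)
    then have "D U V h q - D' U V h q = D V U h q - D' V U h q" for h q
      by (simp add: algebra_simps)
    then show ?thesis by (simp add: S_def vdiff_def)
  qed
  have g_S: "g (S U V) W q = g (D U V) W q - g (D' U V) W q"
    if "U \<in> vector_fields A" "V \<in> vector_fields A" "W \<in> vector_fields A" for U V W q
    using one_form_vdiff[OF atlas g_form[OF that(3)], of "D U V" "D' U V"] vf[OF that(1,2)]
      g_sym[OF that(3)] S_vf[OF that(1,2)]
    by (simp add: S_def)
  have S_skew: "g (S U V) W q = - g (S U W) V q"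
    if "U \<in> vector_fields A" "V \<in> vector_fields A" "W \<in> vector_fields A" for U V W q
  proof -
    have "U (g V W) q = g (D U V) W q + g V (D U W) q"
      "U (g V W) q = g (D' U V) W q + g V (D' U W) q"
      using D D' that by (simp_all add: is_levi_civita_def)
    then show ?thesis
      using g_sym[OF that(2)] vf[OF that(1,3)] by (simp add: g_S that)
  qed
  show "D X Y f p = D' X Y f p"
  proof (cases "X \<in> vector_fields A \<and> Y \<in> vector_fields A")
    case True
    have "g (S X Y) Z q = 0" if Z: "Z \<in> vector_fields A" for Z q
    proof -
      have XY: "X \<in> vector_fields A" "Y \<in> vector_fields A" using True by auto
      have "g (S X Y) Z q = - g (S Y Z) X q"
        using S_sym[OF XY] S_skew[OF XY(2,1) Z] by simp
      also have "\<dots> = g (S Z X) Y q"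
        using S_sym[OF XY(2) Z] S_skew[OF Z XY(2,1)] by simp
      also have "\<dots> = - g (S X Y) Z q"
        using S_sym[OF Z XY(1)] S_skew[OF XY(1) Z XY(2)] by simp
      finally show ?thesis by simp
    qed
    with True have "S X Y f p = 0"
      using metric S_vf[of X Y] by (simp add: pseudo_riemannian_metric_def)
    then show ?thesis by (simp add: S_def vdiff_def)
  next
    case False
    with affine show ?thesis unfolding affine_connection_def by metis
  qed
qed

lemma levi_civita_eqI:
  fixes A :: "('p::topological_space, 'm::euclidean_space) atlas"
  assumes "smooth_atlas A" "pseudo_riemannian_metric A g" "is_levi_civita A g D"
  shows "levi_civita A g = D"
  unfolding levi_civita_def
  using assms is_levi_civita_unique by (intro the_equality) blast+

section \<open>Pseudo-orthonormal frames\<close>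

lemma vadd_apply: "vadd X Y f p = X f p + Y f p"
  by (simp add: vadd_def)

lemma vscale_apply: "vscale h X f p = h p * X f p"
  by (simp add: vscale_def)

text \<open>The functions \<open>g (e i) (e j)\<close> are required to be constant, with signs \<open>\<epsilon> i\<close> on the diagonal. This
  makes the components of a vector field smooth, because they are metric products with the frame.\<close>

locale pseudo_orthonormal_frame =
  fixes A :: "('p::topological_space, 'm::euclidean_space) atlas"
    and e :: "'i::finite \<Rightarrow> 'p vfield"
    and g :: "'p vfield \<Rightarrow> 'p vfield \<Rightarrow> 'p \<Rightarrow> real"
    and \<epsilon> :: "'i \<Rightarrow> real"
  assumes atlas: "smooth_atlas A"
    and frame: "global_frame A e"
    and metric: "pseudo_riemannian_metric A g"
    and orthonormal: "\<And>i j p. g (e i) (e j) p = (if i = j then \<epsilon> i else 0)"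
    and sign_square: "\<And>i. \<epsilon> i * \<epsilon> i = 1"
begin

definition frame_sum :: "('i \<Rightarrow> 'p \<Rightarrow> real) \<Rightarrow> 'p vfield" where
  "frame_sum h = (\<lambda>f p. \<Sum>i\<in>UNIV. h i p * e i f p)"

lemma frame_vf: "e i \<in> vector_fields A"
  using frame by (simp add: global_frame_def)

lemma metric_one_form: "X \<in> vector_fields A \<Longrightarrow> one_form A (g X)"
  using metric by (simp add: pseudo_riemannian_metric_def)

lemma metric_sym: "X \<in> vector_fields A \<Longrightarrow> Y \<in> vector_fields A \<Longrightarrow> g X Y = g Y X"
  using metric by (simp add: pseudo_riemannian_metric_def)

lemma metric_frame:
  assumes "X \<in> vector_fields A"
  shows "g X (e i) p = \<epsilon> i * component e X i p"
proof -
  have "g X (e i) p = (\<Sum>j\<in>UNIV. component e X j p * g (e i) (e j) p)"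
    using one_form_pointwise[OF atlas frame assms metric_one_form[OF frame_vf]]
    by (simp add: metric_sym[OF assms frame_vf])
  also have "\<dots> = (\<Sum>j\<in>UNIV. if i = j then \<epsilon> i * component e X j p else 0)"
    by (intro sum.cong) (auto simp: orthonormal)
  finally show ?thesis by simp
qed

lemma component_eq_metric:
  assumes "X \<in> vector_fields A"
  shows "component e X i = (\<lambda>p. \<epsilon> i * g X (e i) p)"
  by (simp add: metric_frame[OF assms] sign_square flip: mult.assoc)

lemma component_smooth:
  assumes "X \<in> vector_fields A"
  shows "component e X i \<in> smooth_functions A"
  using metric_one_form[OF assms] frame_vf
  by (auto simp: component_eq_metric[OF assms] one_form_def
      intro!: smooth_functions_mult[OF atlas] smooth_functions_const)

lemma frame_sum_vf:
  assumes "\<And>i. h i \<in> smooth_functions A"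
  shows "frame_sum h \<in> vector_fields A"
  unfolding frame_sum_def using assms by (intro vector_fields_sum[OF atlas] frame_vf) auto

lemma component_frame_sum:
  assumes "\<And>i. h i \<in> smooth_functions A"
  shows "component e (frame_sum h) i = h i"
proof
  fix p
  show "component e (frame_sum h) i p = h i p"
    using assms
    by (intro component_unique[OF atlas frame, where c = "\<lambda>i. h i p"] frame_sum_vf)
      (auto simp: frame_sum_def)
qed

lemma frame_sum_component:
  assumes "X \<in> vector_fields A"
  shows "frame_sum (component e X) = X"
  unfolding frame_sum_def by (intro ext) (simp add: frame_expansion[OF atlas frame assms])

lemma component_frame: "component e (e i) j p = (if i = j then 1 else 0)"
  by (simp add: component_eq_metric[OF frame_vf] orthonormal sign_square)

lemma component_vadd:
  assumes "X \<in> vector_fields A" "Y \<in> vector_fields A"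
  shows "component e (vadd X Y) i = (\<lambda>p. component e X i p + component e Y i p)"
proof
  fix p
  show "component e (vadd X Y) i p = component e X i p + component e Y i p"
    using assms
    by (intro component_unique[OF atlas frame, where c = "\<lambda>i. component e X i p + component e Y i p"]
        vadd_in_vector_fields[OF atlas])
      (auto simp: vadd_def frame_expansion[OF atlas frame] distrib_right sum.distrib)
qed

lemma component_vscale:
  assumes "h \<in> smooth_functions A" "X \<in> vector_fields A"
  shows "component e (vscale h X) i = (\<lambda>p. h p * component e X i p)"
proof
  fix p
  show "component e (vscale h X) i p = h p * component e X i p"
    using assms
    by (intro component_unique[OF atlas frame, where c = "\<lambda>i. h p * component e X i p"]
        vscale_in_vector_fields[OF atlas])
      (auto simp: vscale_def frame_expansion[OF atlas frame] sum_distrib_left mult.assoc)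
qed

lemma component_vdiff:
  assumes "X \<in> vector_fields A" "Y \<in> vector_fields A"
  shows "component e (vdiff X Y) i = (\<lambda>p. component e X i p - component e Y i p)"
  by (simp add: vdiff_eq_vadd_vscale component_vadd component_vscale assms smooth_functions_const
      vscale_in_vector_fields[OF atlas])

lemma metric_components:
  assumes "X \<in> vector_fields A" "Y \<in> vector_fields A"
  shows "g X Y p = (\<Sum>i\<in>UNIV. \<epsilon> i * component e X i p * component e Y i p)"
  by (subst one_form_pointwise[OF atlas frame assms(2) metric_one_form[OF assms(1)]])
    (simp add: metric_frame[OF assms(1)] mult_ac)

lemma inverse_metric_frame: "inverse_metric e g p $ i $ j = (if i = j then \<epsilon> i else 0)"
proof -
  define M :: "real ^ 'i ^ 'i" where "M = (\<chi> i j. if i = j then \<epsilon> i else 0)"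
  have "(\<Sum>k\<in>UNIV. (if i = k then \<epsilon> i else 0) * (if k = j then \<epsilon> k else 0)) =
      (if i = j then 1 else 0)" for i j
  proof -
    have "(\<Sum>k\<in>UNIV. (if i = k then \<epsilon> i else 0) * (if k = j then \<epsilon> k else 0)) =
        (\<Sum>k\<in>UNIV. if i = k then if i = j then 1 else 0 else 0)"
      by (rule sum.cong) (auto simp: sign_square)
    then show ?thesis by simp
  qed
  then have "M ** M = mat 1"
    by (simp add: M_def matrix_matrix_mult_def mat_def vec_eq_iff)
  then have "matrix_inv M = M"
    unfolding matrix_inv_def
    by (intro some_equality) (auto, metis matrix_mul_assoc matrix_mul_lid matrix_mul_rid)
  then show ?thesis
    by (simp add: inverse_metric_def orthonormal flip: M_def) (simp add: M_def)
qed

text \<open>The second order parts of \<open>X (Y f)\<close> and \<open>Y (X f)\<close> are expanded in the frame and combine to the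
  brackets of the frame fields; the Leibniz rule contributes the derivatives of the components.\<close>

lemma lie_bracket_components:
  assumes X: "X \<in> vector_fields A" and Y: "Y \<in> vector_fields A"
  shows "lie_bracket X Y f p =
    (\<Sum>k\<in>UNIV. (X (component e Y k) p - Y (component e X k) p) * e k f p) +
    (\<Sum>i\<in>UNIV. \<Sum>j\<in>UNIV. component e X i p * component e Y j p * lie_bracket (e i) (e j) f p)"
proof (cases "f \<in> smooth_functions A")
  case True
  have second: "U (V f) p = (\<Sum>k\<in>UNIV. U (component e V k) p * e k f p) +
      (\<Sum>i\<in>UNIV. \<Sum>j\<in>UNIV. component e U i p * component e V j p * e i (e j f) p)"
    if U: "U \<in> vector_fields A" and V: "V \<in> vector_fields A" for U V
  proof -
    note smooth = component_smooth[OF V] vector_field_smooth[OF frame_vf True]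
    have "V f = (\<lambda>q. \<Sum>j\<in>UNIV. component e V j q * e j f q)"
      by (intro ext frame_expansion[OF atlas frame V])
    then have "U (V f) p = (\<Sum>j\<in>UNIV. U (\<lambda>q. component e V j q * e j f q) p)"
      using vector_field_sum[OF atlas U, of UNIV "\<lambda>j q. component e V j q * e j f q"]
        smooth_functions_mult[OF atlas smooth] by simp
    also have "\<dots> = (\<Sum>j\<in>UNIV. U (component e V j) p * e j f p +
        (\<Sum>i\<in>UNIV. component e U i p * component e V j p * e i (e j f) p))"
      by (intro sum.cong refl, simp add: vector_field_mult[OF U smooth]
          frame_expansion[OF atlas frame U, of "e _ f"])
        (simp add: sum_distrib_left mult_ac)
    also have "\<dots> = (\<Sum>k\<in>UNIV. U (component e V k) p * e k f p) +
        (\<Sum>j\<in>UNIV. \<Sum>i\<in>UNIV. component e U i p * component e V j p * e i (e j f) p)"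
      by (rule sum.distrib)
    also have "(\<Sum>j\<in>UNIV. \<Sum>i\<in>UNIV. component e U i p * component e V j p * e i (e j f) p) =
        (\<Sum>i\<in>UNIV. \<Sum>j\<in>UNIV. component e U i p * component e V j p * e i (e j f) p)"
      by (rule sum.swap)
    finally show ?thesis .
  qed
  have "(\<Sum>i\<in>UNIV. \<Sum>j\<in>UNIV. component e Y i p * component e X j p * e i (e j f) p) =
      (\<Sum>i\<in>UNIV. \<Sum>j\<in>UNIV. component e X i p * component e Y j p * e j (e i f) p)"
    by (subst sum.swap) (simp add: mult_ac)
  then show ?thesis
    unfolding lie_bracket_def second[OF X Y] second[OF Y X]
    by (simp add: algebra_simps sum_subtractf)
next
  case False
  then have zero: "U f = (\<lambda>q. 0)" if "U \<in> vector_fields A" for U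
    using vector_field_outside[OF that] by (intro ext) auto
  show ?thesis
    by (simp add: lie_bracket_def zero X Y frame_vf vector_field_const[OF X]
        vector_field_const[OF Y] vector_field_const[OF frame_vf])
qed

text \<open>The \<open>k\<close>-th component of the covariant derivative of \<open>Y\<close> along \<open>X\<close>, for the connection with constant
  Christoffel symbols: the derivative of \<open>e j\<close> along \<open>e i\<close> has the components \<open>\<Gamma> i j k\<close>.\<close>

definition connection_coeff ::
  "('i \<Rightarrow> 'i \<Rightarrow> 'i \<Rightarrow> real) \<Rightarrow> 'p vfield \<Rightarrow> 'p vfield \<Rightarrow> 'i \<Rightarrow> 'p \<Rightarrow> real" where
  "connection_coeff \<Gamma> X Y k = (\<lambda>p. X (component e Y k) p +
     (\<Sum>i\<in>UNIV. \<Sum>j\<in>UNIV. \<Gamma> i j k * component e X i p * component e Y j p))"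

definition frame_connection ::
  "('i \<Rightarrow> 'i \<Rightarrow> 'i \<Rightarrow> real) \<Rightarrow> 'p vfield \<Rightarrow> 'p vfield \<Rightarrow> 'p vfield" where
  "frame_connection \<Gamma> X Y =
     (if X \<in> vector_fields A \<and> Y \<in> vector_fields A then frame_sum (connection_coeff \<Gamma> X Y)
      else vzero)"

lemma connection_coeff_smooth:
  assumes "X \<in> vector_fields A" "Y \<in> vector_fields A"
  shows "connection_coeff \<Gamma> X Y k \<in> smooth_functions A"
  unfolding connection_coeff_def
  by (intro smooth_functions_add[OF atlas] smooth_functions_sum[OF atlas]
      smooth_functions_mult[OF atlas] smooth_functions_const component_smooth assms
      vector_field_smooth[OF assms(1) component_smooth[OF assms(2)]])

lemma component_frame_connection:
  assumes "X \<in> vector_fields A" "Y \<in> vector_fields A"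
  shows "component e (frame_connection \<Gamma> X Y) k = connection_coeff \<Gamma> X Y k"
  using assms by (simp add: frame_connection_def component_frame_sum connection_coeff_smooth)

lemma frame_connection_vf:
  assumes "X \<in> vector_fields A" "Y \<in> vector_fields A"
  shows "frame_connection \<Gamma> X Y \<in> vector_fields A"
  using assms by (simp add: frame_connection_def frame_sum_vf connection_coeff_smooth)

lemma vector_field_eqI:
  assumes "X \<in> vector_fields A" "Y \<in> vector_fields A"
    and "\<And>k p. component e X k p = component e Y k p"
  shows "X = Y"
proof -
  have "component e X = component e Y" using assms(3) by blast
  then show ?thesis using frame_sum_component assms(1,2) by metis
qed

lemma affine_connection_frame_connection: "affine_connection A (frame_connection \<Gamma>)"
  unfolding affine_connection_def
proof (intro conjI ballI allI impI)
  fix X Y assume "X \<notin> vector_fields A \<or> Y \<notin> vector_fields A"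
  then show "frame_connection \<Gamma> X Y = vzero" by (auto simp: frame_connection_def)
next
  fix X Y assume "X \<in> vector_fields A" "Y \<in> vector_fields A"
  then show "frame_connection \<Gamma> X Y \<in> vector_fields A" by (rule frame_connection_vf)
next
  fix X Y Z
  assume vf: "X \<in> vector_fields A" "Y \<in> vector_fields A" "Z \<in> vector_fields A"
  note closed = vadd_in_vector_fields[OF atlas] frame_connection_vf
  show "frame_connection \<Gamma> (vadd X Y) Z = vadd (frame_connection \<Gamma> X Z) (frame_connection \<Gamma> Y Z)"
    by (rule vector_field_eqI)
      (simp_all add: vf closed component_frame_connection component_vadd connection_coeff_def
        vadd_apply distrib_left distrib_right sum.distrib)
  show "frame_connection \<Gamma> X (vadd Y Z) = vadd (frame_connection \<Gamma> X Y) (frame_connection \<Gamma> X Z)"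
    by (rule vector_field_eqI)
      (simp_all add: vf closed component_frame_connection component_vadd connection_coeff_def
        vector_field_add[OF vf(1)] component_smooth distrib_left sum.distrib)
next
  fix h X Y
  assume h: "h \<in> smooth_functions A" and vf: "X \<in> vector_fields A" "Y \<in> vector_fields A"
  note closed = vscale_in_vector_fields[OF atlas] vadd_in_vector_fields[OF atlas]
    frame_connection_vf vector_field_smooth
  show "frame_connection \<Gamma> (vscale h X) Y = vscale h (frame_connection \<Gamma> X Y)"
    by (rule vector_field_eqI)
      (simp_all add: h vf closed component_frame_connection component_vscale connection_coeff_def
        vscale_apply distrib_left sum_distrib_left mult_ac)
  show "frame_connection \<Gamma> X (vscale h Y) =
      vadd (vscale (X h) Y) (vscale h (frame_connection \<Gamma> X Y))"
    by (rule vector_field_eqI)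
      (simp_all add: h vf closed component_frame_connection component_vscale component_vadd
        connection_coeff_def vector_field_mult[OF vf(1)] component_smooth distrib_left sum_distrib_left mult_ac)
qed

text \<open>Torsion and the derivative of the metric are tensors, so it is enough that they vanish on the frame.
  There, vanishing torsion says that the brackets have the structure constants
  \<open>\<Gamma> i j k - \<Gamma> j i k\<close>. Metricity says that \<open>\<epsilon> k * \<Gamma> i j k\<close>, which is the metric product of the
  derivative of \<open>e j\<close> along \<open>e i\<close> with \<open>e k\<close>, is skew in \<open>j\<close> and \<open>k\<close>, since
  the metric is constant on the frame.\<close>

lemma is_levi_civita_frame_connection:
  assumes torsion_free: "\<And>i j f p.
      lie_bracket (e i) (e j) f p = (\<Sum>k\<in>UNIV. (\<Gamma> i j k - \<Gamma> j i k) * e k f p)"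
    and skew: "\<And>i j k. \<epsilon> k * \<Gamma> i j k = - \<epsilon> j * \<Gamma> i k j"
  shows "is_levi_civita A g (frame_connection \<Gamma>)"
  unfolding is_levi_civita_def
proof (intro conjI ballI allI affine_connection_frame_connection)
  fix X Y assume vf: "X \<in> vector_fields A" "Y \<in> vector_fields A"
  let ?x = "component e X" and ?y = "component e Y"
  show "vdiff (frame_connection \<Gamma> X Y) (frame_connection \<Gamma> Y X) = lie_bracket X Y"
  proof (intro ext)
    fix f p
    have "(\<Sum>i\<in>UNIV. \<Sum>j\<in>UNIV. ?x i p * ?y j p * lie_bracket (e i) (e j) f p) =
        (\<Sum>i\<in>UNIV. \<Sum>j\<in>UNIV. \<Sum>k\<in>UNIV. ?x i p * ?y j p * (\<Gamma> i j k - \<Gamma> j i k) * e k f p)"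
      by (simp add: torsion_free sum_distrib_left mult.assoc)
    also have "\<dots> = (\<Sum>i\<in>UNIV. \<Sum>k\<in>UNIV. \<Sum>j\<in>UNIV. ?x i p * ?y j p * (\<Gamma> i j k - \<Gamma> j i k) * e k f p)"
      by (intro sum.cong refl sum.swap)
    also have "\<dots> = (\<Sum>k\<in>UNIV. \<Sum>i\<in>UNIV. \<Sum>j\<in>UNIV. ?x i p * ?y j p * (\<Gamma> i j k - \<Gamma> j i k) * e k f p)"
      by (rule sum.swap)
    also have "\<dots> = (\<Sum>k\<in>UNIV. (\<Sum>i\<in>UNIV. \<Sum>j\<in>UNIV. \<Gamma> i j k * ?x i p * ?y j p) * e k f p) -
        (\<Sum>k\<in>UNIV. (\<Sum>i\<in>UNIV. \<Sum>j\<in>UNIV. \<Gamma> j i k * ?x i p * ?y j p) * e k f p)"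
      by (simp add: sum_distrib_right sum_subtractf left_diff_distrib right_diff_distrib)
        (simp add: mult_ac)
    also have "(\<Sum>k\<in>UNIV. (\<Sum>i\<in>UNIV. \<Sum>j\<in>UNIV. \<Gamma> j i k * ?x i p * ?y j p) * e k f p) =
        (\<Sum>k\<in>UNIV. (\<Sum>i\<in>UNIV. \<Sum>j\<in>UNIV. \<Gamma> i j k * ?y i p * ?x j p) * e k f p)"
      by (subst sum.swap) (simp add: mult_ac)
    finally show "vdiff (frame_connection \<Gamma> X Y) (frame_connection \<Gamma> Y X) f p = lie_bracket X Y f p"
      by (simp add: lie_bracket_components[OF vf] vdiff_def frame_connection_def vf frame_sum_def
          connection_coeff_def distrib_right left_diff_distrib sum.distrib sum_subtractf)
  qed
next
  fix X Y Z p
  assume vf: "X \<in> vector_fields A" "Y \<in> vector_fields A" "Z \<in> vector_fields A"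
  let ?x = "component e X" and ?y = "component e Y" and ?z = "component e Z"
  note smooth = component_smooth[OF vf(2)] component_smooth[OF vf(3)]
  have "X (g Y Z) p = X (\<lambda>q. \<Sum>k\<in>UNIV. \<epsilon> k * (?y k q * ?z k q)) p"
    by (rule arg_cong[where f = "\<lambda>h. X h p"])
      (simp add: fun_eq_iff metric_components[OF vf(2,3)] mult.assoc)
  also have "\<dots> = (\<Sum>k\<in>UNIV. \<epsilon> k * (?y k p * X (?z k) p + ?z k p * X (?y k) p))"
    using smooth
    by (subst vector_field_sum[OF atlas vf(1)])
      (simp_all add: vector_field_cmult[OF vf(1)] vector_field_mult[OF vf(1)]
        smooth_functions_mult[OF atlas] smooth_functions_const)
  finally have derivative: "X (g Y Z) p =
      (\<Sum>k\<in>UNIV. \<epsilon> k * (?y k p * X (?z k) p + ?z k p * X (?y k) p))" .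
  have "(\<Sum>k\<in>UNIV. \<Sum>i\<in>UNIV. \<Sum>j\<in>UNIV. \<epsilon> k * \<Gamma> i j k * ?x i p * ?z j p * ?y k p) =
      (\<Sum>i\<in>UNIV. \<Sum>k\<in>UNIV. \<Sum>j\<in>UNIV. \<epsilon> k * \<Gamma> i j k * ?x i p * ?z j p * ?y k p)"
    by (rule sum.swap)
  also have "\<dots> = (\<Sum>i\<in>UNIV. \<Sum>j\<in>UNIV. \<Sum>k\<in>UNIV. \<epsilon> k * \<Gamma> i j k * ?x i p * ?z j p * ?y k p)"
    by (intro sum.cong refl sum.swap)
  also have "\<dots> = (\<Sum>i\<in>UNIV. \<Sum>j\<in>UNIV. \<Sum>k\<in>UNIV. - (\<epsilon> j * \<Gamma> i k j * ?x i p * ?y k p * ?z j p))"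
    by (intro sum.cong refl) (subst skew, simp)
  also have "\<dots> = (\<Sum>j\<in>UNIV. \<Sum>i\<in>UNIV. \<Sum>k\<in>UNIV. - (\<epsilon> j * \<Gamma> i k j * ?x i p * ?y k p * ?z j p))"
    by (rule sum.swap)
  also have "\<dots> = - (\<Sum>j\<in>UNIV. \<Sum>i\<in>UNIV. \<Sum>k\<in>UNIV. \<epsilon> j * \<Gamma> i k j * ?x i p * ?y k p * ?z j p)"
    by (simp add: sum_negf)
  finally have cancel: "(\<Sum>k\<in>UNIV. \<Sum>i\<in>UNIV. \<Sum>j\<in>UNIV. \<epsilon> k * \<Gamma> i j k * ?x i p * ?y j p * ?z k p) +
      (\<Sum>k\<in>UNIV. \<Sum>i\<in>UNIV. \<Sum>j\<in>UNIV. \<epsilon> k * \<Gamma> i j k * ?x i p * ?z j p * ?y k p) = 0"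
    by simp
  have "g (frame_connection \<Gamma> X Y) Z p + g Y (frame_connection \<Gamma> X Z) p =
      (\<Sum>k\<in>UNIV. \<epsilon> k * (?y k p * X (?z k) p + ?z k p * X (?y k) p)) +
      ((\<Sum>k\<in>UNIV. \<Sum>i\<in>UNIV. \<Sum>j\<in>UNIV. \<epsilon> k * \<Gamma> i j k * ?x i p * ?y j p * ?z k p) +
       (\<Sum>k\<in>UNIV. \<Sum>i\<in>UNIV. \<Sum>j\<in>UNIV. \<epsilon> k * \<Gamma> i j k * ?x i p * ?z j p * ?y k p))"
    by (simp add: metric_components vf frame_connection_vf component_frame_connection
        connection_coeff_def algebra_simps sum.distrib sum_distrib_left sum_distrib_right)
  then show "X (g Y Z) p = g (frame_connection \<Gamma> X Y) Z p + g Y (frame_connection \<Gamma> X Z) p"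
    by (simp add: derivative cancel)
qed

end

section \<open>Three-dimensional almost contact B-metric frames\<close>

text \<open>In the type \<open>3\<close> the numeral \<open>3\<close> denotes \<open>0\<close>; these variants of the standard rules use the
  representatives \<open>0\<close>, \<open>1\<close>, \<open>2\<close>.\<close>

lemma sum_UNIV_012: "sum f (UNIV :: 3 set) = f 0 + f 1 + f 2"
proof -
  have "(3 :: 3) = 0" by simp
  then show ?thesis unfolding sum_3 by (simp only: ac_simps)
qed

lemma cases_012:
  fixes i :: 3
  obtains "i = 0" | "i = 1" | "i = 2"
  using exhaust_3[of i] by auto

locale contact_B_frame = pseudo_orthonormal_frame A e g "\<lambda>i. if i = 2 then - 1 else 1"
  for A :: "('p::topological_space, real ^ 3) atlas"
    and e :: "3 \<Rightarrow> 'p vfield"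
    and g :: "'p vfield \<Rightarrow> 'p vfield \<Rightarrow> 'p \<Rightarrow> real" +
  fixes \<phi> :: "'p vfield \<Rightarrow> 'p vfield" and \<eta> :: "'p vfield \<Rightarrow> 'p \<Rightarrow> real"
  assumes tensor: "tensor_1_1 A \<phi>"
    and \<phi>_frame: "\<phi> (e 0) = vzero" "\<phi> (e 1) = e 2" "\<phi> (e 2) = (\<lambda>f p. - e 1 f p)"
    and one_form: "one_form A \<eta>"
    and \<eta>_frame: "\<And>p. \<eta> (e 0) p = 1" "\<And>p. \<eta> (e 1) p = 0" "\<And>p. \<eta> (e 2) p = 0"
begin

lemma \<phi>_vf: "X \<in> vector_fields A \<Longrightarrow> \<phi> X \<in> vector_fields A"
  using tensor by (simp add: tensor_1_1_def)

lemma component_\<phi>: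
  assumes X: "X \<in> vector_fields A"
  shows "component e (\<phi> X) 0 = (\<lambda>p. 0)"
    and "component e (\<phi> X) 1 = (\<lambda>p. - component e X 2 p)"
    and "component e (\<phi> X) 2 = component e X 1"
proof -
  define h :: "3 \<Rightarrow> 'p \<Rightarrow> real"
    where "h i = (if i = 1 then \<lambda>p. - component e X 2 p else if i = 2 then component e X 1 else (\<lambda>p. 0))"
    for i
  have "(\<lambda>p. (- 1) * component e X 2 p) \<in> smooth_functions A"
    by (intro smooth_functions_mult[OF atlas] smooth_functions_const component_smooth X)
  then have h_smooth: "h i \<in> smooth_functions A" for i
    by (simp add: h_def component_smooth[OF X] smooth_functions_const)
  have "\<phi> X = \<phi> (\<lambda>f p. \<Sum>i\<in>UNIV. component e X i p * e i f p)"
    using frame_sum_component[OF X] by (simp add: frame_sum_def)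
  also have "\<dots> = (\<lambda>f p. \<Sum>i\<in>UNIV. component e X i p * \<phi> (e i) f p)"
    by (intro tensor_1_1_sum[OF atlas tensor] frame_vf component_smooth[OF X]) simp
  also have "\<dots> = frame_sum h"
    by (simp add: frame_sum_def sum_UNIV_012 \<phi>_frame vzero_def h_def)
  finally have "component e (\<phi> X) i = h i" for i
    using component_frame_sum[of h, OF h_smooth] by simp
  then show "component e (\<phi> X) 0 = (\<lambda>p. 0)"
    "component e (\<phi> X) 1 = (\<lambda>p. - component e X 2 p)"
    "component e (\<phi> X) 2 = component e X 1"
    by (simp_all add: h_def)
qed

lemma \<eta>_eq_component:
  assumes "X \<in> vector_fields A"
  shows "\<eta> X p = component e X 0 p"
  by (subst one_form_pointwise[OF atlas frame assms one_form]) (simp add: sum_UNIV_012 \<eta>_frame)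

lemma almost_contact_B_metric_frame: "almost_contact_B_metric A \<phi> (e 0) \<eta> g"
  unfolding almost_contact_B_metric_def
proof (intro conjI ballI allI atlas tensor frame_vf one_form metric \<phi>_frame(1) \<eta>_frame(1))
  show "odd DIM(real ^ 3)" by simp
next
  fix X assume X: "X \<in> vector_fields A"
  have \<eta>X: "\<eta> X \<in> smooth_functions A"
    using one_form X by (simp add: one_form_def)
  note vf = X \<phi>_vf frame_vf vscale_in_vector_fields[OF atlas \<eta>X] vdiff_in_vector_fields[OF atlas]
  show "\<phi> (\<phi> X) = vdiff (vscale (\<eta> X) (e 0)) X"
  proof (rule vector_field_eqI)
    show "component e (\<phi> (\<phi> X)) k p = component e (vdiff (vscale (\<eta> X) (e 0)) X) k p" for k p
      by (cases k rule: cases_012)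
        (simp_all add: vf component_\<phi> component_vdiff component_vscale \<eta>X component_frame
          \<eta>_eq_component)
  qed (simp_all add: vf)
  show "\<eta> (\<phi> X) p = 0" for p
    by (simp add: \<eta>_eq_component vf component_\<phi>)
next
  fix X Y p assume "X \<in> vector_fields A" "Y \<in> vector_fields A"
  then show "g (\<phi> X) (\<phi> Y) p = - g X Y p + \<eta> X p * \<eta> Y p"
    by (simp add: metric_components \<phi>_vf component_\<phi> \<eta>_eq_component sum_UNIV_012)
qed

end

section \<open>The Levi-Civita connection of the Lie algebra\<close>

text \<open>These are the solutions of Koszul's formula for a frame with constant metric,
  \<open>2 \<epsilon>\<^sub>k \<Gamma>\<^sub>i\<^sub>j\<^sub>k = g([e\<^sub>i, e\<^sub>j], e\<^sub>k) + g([e\<^sub>k, e\<^sub>i], e\<^sub>j) + g([e\<^sub>k, e\<^sub>j], e\<^sub>i)\<close>.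
  Explicitly, \<open>\<nabla>\<^sub>1 e\<^sub>0 = b e\<^sub>1 + a e\<^sub>2\<close>, \<open>\<nabla>\<^sub>2 e\<^sub>0 = - a e\<^sub>1 + b e\<^sub>2\<close>, \<open>\<nabla>\<^sub>1 e\<^sub>1 = - b e\<^sub>0\<close>,
  \<open>\<nabla>\<^sub>1 e\<^sub>2 = \<nabla>\<^sub>2 e\<^sub>1 = a e\<^sub>0\<close>, \<open>\<nabla>\<^sub>2 e\<^sub>2 = b e\<^sub>0\<close>, and the frame is parallel along \<open>e\<^sub>0\<close>.\<close>

definition christoffel :: "real \<Rightarrow> real \<Rightarrow> 3 \<Rightarrow> 3 \<Rightarrow> 3 \<Rightarrow> real" where
  "christoffel a b i j k =
     (if (i, j, k) \<in> {(1, 0, 1), (2, 0, 2), (2, 2, 0)} then b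
      else if (i, j, k) = (1, 1, 0) then - b
      else if (i, j, k) \<in> {(1, 0, 2), (1, 2, 0), (2, 1, 0)} then a
      else if (i, j, k) = (2, 0, 1) then - a else 0)"

locale F4_F5_frame = contact_B_frame A e g \<phi> \<eta>
  for A :: "('p::topological_space, real ^ 3) atlas"
    and e :: "3 \<Rightarrow> 'p vfield" and g \<phi> \<eta> +
  fixes a b :: real
  assumes bracket_01: "lie_bracket (e 0) (e 1) = (\<lambda>f p. - b * e 1 f p - a * e 2 f p)"
    and bracket_02: "lie_bracket (e 0) (e 2) = (\<lambda>f p. a * e 1 f p - b * e 2 f p)"
    and bracket_12: "lie_bracket (e 1) (e 2) = vzero"
begin

lemma levi_civita_eq: "levi_civita A g = frame_connection (christoffel a b)"
proof (rule levi_civita_eqI[OF atlas metric], rule is_levi_civita_frame_connection)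
  have swap: "lie_bracket X Y f p = - lie_bracket Y X f p" for X Y :: "'p vfield" and f p
    by (simp add: lie_bracket_def)
  have self: "lie_bracket X X f p = 0" for X :: "'p vfield" and f p
    by (simp add: lie_bracket_def)
  note brackets = bracket_01 bracket_02 bracket_12 self
    swap[of "e 1" "e 0"] swap[of "e 2" "e 0"] swap[of "e 2" "e 1"]
  fix i j f p
  show "lie_bracket (e i) (e j) f p =
      (\<Sum>k\<in>UNIV. (christoffel a b i j k - christoffel a b j i k) * e k f p)"
    by (cases i rule: cases_012; cases j rule: cases_012)
      (simp_all add: brackets christoffel_def sum_UNIV_012 vzero_def)
next
  fix i j k
  show "(if k = 2 then - 1 else 1) * christoffel a b i j k =
      - (if j = 2 then - 1 else 1) * christoffel a b i k j"
    by (cases i rule: cases_012; cases j rule: cases_012; cases k rule: cases_012)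
      (simp_all add: christoffel_def)
qed

text \<open>The frame components of \<open>\<phi> Y\<close> are those of \<open>Y\<close> permuted with signs, so the derivatives of the
  components cancel in \<open>\<nabla>\<^sub>X (\<phi> Y) - \<phi> (\<nabla>\<^sub>X Y)\<close>. What is left is linear in the Christoffel symbols:
  \<open>a\<close> times the shape of \<^const>\<open>F4_tensor\<close> plus \<open>b\<close> times the shape of \<^const>\<open>F5_tensor\<close>.\<close>

lemma fundamental_tensor_components:
  assumes X: "X \<in> vector_fields A" and Y: "Y \<in> vector_fields A" and Z: "Z \<in> vector_fields A"
  shows "fundamental_tensor A \<phi> g X Y Z p =
    (let x = \<lambda>i. component e X i p; y = \<lambda>i. component e Y i p; z = \<lambda>i. component e Z i p
     in a * (x 1 * (y 0 * z 1 + y 1 * z 0) - x 2 * (y 0 * z 2 + y 2 * z 0)) +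
        b * (x 1 * (y 0 * z 2 + y 2 * z 0) + x 2 * (y 0 * z 1 + y 1 * z 0)))"
proof -
  note vf = X Y Z \<phi>_vf frame_connection_vf vdiff_in_vector_fields[OF atlas]
  have X_neg: "X (\<lambda>q. - component e Y 2 q) p = - X (component e Y 2) p"
    using vector_field_cmult[OF X component_smooth[OF Y], of "- 1" 2 p] by simp
  show ?thesis
    unfolding fundamental_tensor_def levi_civita_eq Let_def
    by (simp add: vf metric_components component_vdiff component_\<phi> component_frame_connection
        connection_coeff_def sum_UNIV_012 X_neg vector_field_const[OF X])
      (simp add: christoffel_def algebra_simps)
qed

text \<open>The Lee forms are traces of the fundamental tensor. On \<open>\<xi>\<close>, the indices \<open>1\<close> and \<open>2\<close> contribute
  equally, so that the factor \<open>1/2\<close> in \<^const>\<open>F4_tensor\<close> and \<^const>\<open>F5_tensor\<close> restores the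
  coefficients \<open>a\<close> and \<open>b\<close>.\<close>

lemma lee_form_xi: "lee_form A e \<phi> g (e 0) p = 2 * a"
  by (simp add: lee_form_def inverse_metric_frame sum_UNIV_012 fundamental_tensor_components
      frame_vf component_frame)

lemma lee_form_star_xi: "lee_form_star A e \<phi> g (e 0) p = 2 * b"
  by (simp add: lee_form_star_def inverse_metric_frame sum_UNIV_012 fundamental_tensor_components
      frame_vf \<phi>_vf component_frame component_\<phi>)

lemma class_F4_F5_frame: "class_F4_F5 A e \<phi> g"
  by (simp add: class_F4_F5_def F4_tensor_def F5_tensor_def lee_form_xi lee_form_star_xi
      fundamental_tensor_components Let_def)

end

theorem theorem2p1:
  fixes a b :: real
    and G :: "('p::{t2_space,second_countable_topology}, 'r) monoid_scheme"
    and A :: "('p, real ^ 3) atlas"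
    and e :: "3 \<Rightarrow> 'p vfield"
    and \<phi> :: "'p vfield \<Rightarrow> 'p vfield"
    and \<xi> :: "'p vfield"
    and \<eta> :: "'p vfield \<Rightarrow> 'p \<Rightarrow> real"
    and g :: "'p vfield \<Rightarrow> 'p vfield \<Rightarrow> 'p \<Rightarrow> real"
  assumes "lie_group G A" and "connected (UNIV :: 'p set)"
    and "global_frame A e" and "\<And>i. left_invariant_vfield G (e i)"
    and "lie_bracket (e 0) (e 1) = (\<lambda>f p. - b * e 1 f p - a * e 2 f p)"
    and "lie_bracket (e 0) (e 2) = (\<lambda>f p. a * e 1 f p - b * e 2 f p)"
    and "lie_bracket (e 1) (e 2) = vzero"
    and "tensor_1_1 A \<phi>" and "left_invariant_tensor_1_1 G A \<phi>"
    and "\<phi> (e 0) = vzero" and "\<phi> (e 1) = e 2" and "\<phi> (e 2) = (\<lambda>f p. - e 1 f p)"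
    and "\<xi> = e 0"
    and "one_form A \<eta>" and "left_invariant_one_form G A \<eta>"
    and "\<And>p. \<eta> (e 0) p = 1" and "\<And>p. \<eta> (e 1) p = 0" and "\<And>p. \<eta> (e 2) p = 0"
    and "pseudo_riemannian_metric A g" and "left_invariant_metric G A g"
    and "\<And>p. g (e 0) (e 0) p = 1" and "\<And>p. g (e 1) (e 1) p = 1"
    and "\<And>p. - g (e 2) (e 2) p = 1"
    and "\<And>p. g (e 0) (e 1) p = 0" and "\<And>p. g (e 0) (e 2) p = 0"
    and "\<And>p. g (e 1) (e 2) p = 0"
  shows "almost_contact_B_metric A \<phi> \<xi> \<eta> g \<and> class_F4_F5 A e \<phi> g"
proof -
  have orthonormal: "g (e i) (e j) p = (if i = j then if i = 2 then - 1 else 1 else 0)" for i j p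
  proof -
    have vf: "e k \<in> vector_fields A" for k
      using assms(3) by (simp add: global_frame_def)
    have sym: "g (e 1) (e 0) = g (e 0) (e 1)" "g (e 2) (e 0) = g (e 0) (e 2)"
      "g (e 2) (e 1) = g (e 1) (e 2)"
      using assms(19) vf by (simp_all add: pseudo_riemannian_metric_def)
    have "g (e 2) (e 2) p = - 1" using assms(23)[of p] by linarith
    then show ?thesis
      by (cases i rule: cases_012; cases j rule: cases_012) (simp_all add: sym assms(21,22,24-26))
  qed
  have "smooth_atlas A" using assms(1) by (simp add: lie_group_def)
  then interpret F4_F5_frame A e g \<phi> \<eta> a b
    by unfold_locales (use orthonormal assms in auto)
  show ?thesis
    using almost_contact_B_metric_frame class_F4_F5_frame assms(13) by simp
qed

end
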